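(* Let $\mathcal{V}$ be a finite set, $\theta\in\mathbb{R}^d$, let $\pi_\theta$ be a probability distribution on $\mathcal{V}$ with $\pi_\theta(j)>0$ differentiable in $\theta$ for every $j\in\mathcal{V}$, and let $\pi_{\mathrm{ref}}$ be a probability distribution on $\mathcal{V}$, independent of $\theta$, with $\pi_{\mathrm{ref}}(j)>0$ for all $j$. For $p\in\mathcal{V}$ let $w=\pi_{\mathrm{ref}}(p)/\pi_\theta(p)$ and $r=\pi_\theta(p)/\mathrm{sg}(\pi_\theta(p))$, and define $$\mathrm{K5}=\mathrm{sg}(w)\log w+\log r .$$ Then $\mathrm{K5}$ gives both unbiased values and unbiased gradients of the forward KL divergence $\mathrm{KL}(\pi_{\mathrm{ref}}\|\pi_\theta)=\sum_{j\in\mathcal{V}}\pi_{\mathrm{ref}}(j)\log\frac{\pi_{\mathrm{ref}}(j)}{\pi_\theta(j)}$ under sampling from $\pi_\theta$: $$\mathbb{E}_{p\sim\pi_\theta}\big[\mathrm{K5}\big]=\mathrm{KL}(\pi_{\mathrm{ref}}\|\pi_\theta),\qquad \mathbb{E}_{p\sim\pi_\theta}\big[\nabla_\theta\mathrm{K5}\big]=\nabla_\theta\mathrm{KL}(\pi_{\mathrm{ref}}\|\pi_\theta).$$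
   Context: $\mathrm{sg}(\cdot)$ is the stop-gradient operator: it acts as the identity when an expression is evaluated, but its argument is treated as a constant when the expression is differentiated. Formally, an expression with stop-gradients is a function $E(\theta;\bar\theta)$ where every occurrence of $\theta$ inside an $\mathrm{sg}(\cdot)$ is replaced by $\bar\theta$; its value is $E(\theta;\theta)$ and its gradient is $\nabla_\theta E(\theta;\bar\theta)|_{\bar\theta=\theta}$. In $\mathbb{E}_{p\sim\pi_\theta}[\nabla_\theta(\cdot)]$ the gradient is taken with the sampled element $p$ held fixed, and then averaged over $p$ with weights $\pi_\theta(p)$ (the sampling distribution is not differentiated). In the application $\mathcal{V}$ is a vocabulary and $\pi_\theta,\pi_{\mathrm{ref}}$ are next-token distributions given a fixed prefix. *)

theory Defs
  imports "HOL-Probability.Probability"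
begin

text \<open>The gradient with respect to the inner product, as an operator built on the library
  relation \<^const>\<open>gderiv\<close>. It is unspecified where the function is not differentiable.\<close>

definition gradient :: "('a::real_inner \<Rightarrow> real) \<Rightarrow> 'a \<Rightarrow> 'a" where
  "gradient f x = (THE D. GDERIV f x :> D)"

text \<open>An expression with stop-gradients is a function \<open>E \<theta> \<theta>'\<close> of two arguments, where \<open>\<theta>'\<close> stands
  for the occurrences of the parameter inside \<open>sg\<close>. Nested occurrences are all redirected to \<open>\<theta>'\<close>.\<close>

type_synonym ('a, 'b) sg_expr = "'a \<Rightarrow> 'a \<Rightarrow> 'b"

definition sg :: "('a, 'b) sg_expr \<Rightarrow> ('a, 'b) sg_expr" where
  "sg E = (\<lambda>\<theta> \<theta>'. E \<theta>' \<theta>')"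

definition sg_value :: "('a, 'b) sg_expr \<Rightarrow> 'a \<Rightarrow> 'b" where
  "sg_value E \<theta> = E \<theta> \<theta>"

definition sg_gradient :: "('a::real_inner, real) sg_expr \<Rightarrow> 'a \<Rightarrow> 'a" where
  "sg_gradient E \<theta> = gradient (\<lambda>t. E t \<theta>) \<theta>"

definition sg_differentiable :: "('a::real_inner, real) sg_expr \<Rightarrow> 'a \<Rightarrow> bool" where
  "sg_differentiable E \<theta> \<longleftrightarrow> (\<lambda>t. E t \<theta>) differentiable (at \<theta>)"

definition prob_expr :: "('a \<Rightarrow> 'v pmf) \<Rightarrow> 'v \<Rightarrow> ('a, real) sg_expr" where
  "prob_expr \<pi> p = (\<lambda>\<theta> \<theta>'. pmf (\<pi> \<theta>) p)"

definition w_expr :: "'v pmf \<Rightarrow> ('a \<Rightarrow> 'v pmf) \<Rightarrow> 'v \<Rightarrow> ('a, real) sg_expr" where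
  "w_expr \<pi>ref \<pi> p = (\<lambda>\<theta> \<theta>'. pmf \<pi>ref p / prob_expr \<pi> p \<theta> \<theta>')"

definition r_expr :: "('a \<Rightarrow> 'v pmf) \<Rightarrow> 'v \<Rightarrow> ('a, real) sg_expr" where
  "r_expr \<pi> p = (\<lambda>\<theta> \<theta>'. prob_expr \<pi> p \<theta> \<theta>' / sg (prob_expr \<pi> p) \<theta> \<theta>')"

definition K5 :: "'v pmf \<Rightarrow> ('a \<Rightarrow> 'v pmf) \<Rightarrow> 'v \<Rightarrow> ('a, real) sg_expr" where
  "K5 \<pi>ref \<pi> p = (\<lambda>\<theta> \<theta>'. sg (w_expr \<pi>ref \<pi> p) \<theta> \<theta>' * ln (w_expr \<pi>ref \<pi> p \<theta> \<theta>')
                          + ln (r_expr \<pi> p \<theta> \<theta>'))"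

definition KL :: "'v::finite pmf \<Rightarrow> 'v pmf \<Rightarrow> real" where
  "KL P Q = (\<Sum>j\<in>UNIV. pmf P j * ln (pmf P j / pmf Q j))"

end

(* At theta, the gradient of K5 for a sampled p is (1 - w) / pi(p) times the gradient of pi(p).
   Averaging over p with weights pi(p) leaves the sum of the gradients of pi(p), which vanishes
   because the total mass is constantly 1, minus the sum of w times the gradients of pi(p), which
   is the gradient of the forward KL divergence. *)
theory Submission imports Defs begin

text \<open>Frechet derivatives are unique and a vector is determined by its inner products with all
  \<open>h\<close>, so the definite description in \<open>gradient\<close> picks out
  \<open>D\<close>.\<close>

lemma gradient_eq:
  assumes "GDERIV f x :> D"
  shows "gradient f x = D"
  unfolding gradient_def
proof (rule the_equality[where P = "\<lambda>D. GDERIV f x :> D", OF assms])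
  fix E assume "GDERIV f x :> E"
  then have "(\<lambda>h. h \<bullet> E) = (\<lambda>h. h \<bullet> D)"
    using assms unfolding gderiv_def by (rule has_derivative_unique)
  then have "\<And>h. h \<bullet> E = h \<bullet> D" by (rule fun_cong)
  then show "E = D" by (metis vector_eq_ldot)
qed

lemma gderiv_imp_differentiable: "GDERIV f x :> D \<Longrightarrow> f differentiable (at x)"
  unfolding gderiv_def differentiable_def by blast

text \<open>Riesz representation in finite dimension:
  \<open>f' h = f' h \<bullet> 1 = h \<bullet> adjoint f' 1\<close>, so \<open>adjoint f' 1\<close>
  serves as the gradient.\<close>

lemma differentiable_imp_gderiv:
  fixes f :: "'a::euclidean_space \<Rightarrow> real"
  assumes "f differentiable (at x)"
  obtains D where "GDERIV f x :> D"
proof -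
  obtain f' where f': "(f has_derivative f') (at x)"
    using assms unfolding differentiable_def by blast
  then have "f' = (\<lambda>h. h \<bullet> adjoint f' 1)"
    by (simp add: adjoint_works has_derivative_linear)
  with f' that show thesis unfolding gderiv_def by metis
qed

lemma GDERIV_sum:
  assumes "\<And>i. i \<in> I \<Longrightarrow> GDERIV (f i) x :> D i"
  shows "GDERIV (\<lambda>t. \<Sum>i\<in>I. f i t) x :> (\<Sum>i\<in>I. D i)"
  using assms unfolding gderiv_def inner_sum_right by (rule has_derivative_sum)

lemma GDERIV_cmult:
  fixes f :: "'a::real_inner \<Rightarrow> real"
  shows "GDERIV f x :> D \<Longrightarrow> GDERIV (\<lambda>t. c * f t) x :> c *\<^sub>R D"
  by (rule GDERIV_DERIV_compose[where g = "\<lambda>y. c * y"]) (auto intro!: derivative_eq_intros)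

lemma GDERIV_ln_divide_const:
  assumes "GDERIV f x :> D" "f x > 0" "c > 0"
  shows "GDERIV (\<lambda>t. ln (f t / c)) x :> (1 / f x) *\<^sub>R D"
  by (rule GDERIV_DERIV_compose[where g = "\<lambda>y. ln (y / c)", OF assms(1)])
    (use assms in \<open>auto intro!: derivative_eq_intros\<close>)

lemma GDERIV_ln_const_divide:
  assumes "GDERIV f x :> D" "f x > 0" "c > 0"
  shows "GDERIV (\<lambda>t. ln (c / f t)) x :> (- 1 / f x) *\<^sub>R D"
  by (rule GDERIV_DERIV_compose[where g = "\<lambda>y. ln (c / y)", OF assms(1)])
    (use assms in \<open>auto intro!: derivative_eq_intros simp: field_simps\<close>)

lemma sum_gderiv_pmf_eq_0:
  fixes \<pi> :: "'a::real_inner \<Rightarrow> 'v::finite pmf"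
  assumes "\<And>j. GDERIV (\<lambda>t. pmf (\<pi> t) j) \<theta> :> G j"
  shows "(\<Sum>j\<in>UNIV. G j) = 0"
proof -
  have "GDERIV (\<lambda>t. \<Sum>j\<in>UNIV. pmf (\<pi> t) j) \<theta> :> (\<Sum>j\<in>UNIV. G j)"
    by (rule GDERIV_sum) (rule assms)
  \<comment> \<open>The summed function is the constant 1, whose gradient is also 0; uniqueness
    identifies the two.\<close>
  then have "gradient (\<lambda>t. 1) \<theta> = (\<Sum>j\<in>UNIV. G j)"
    by (intro gradient_eq) (simp add: sum_pmf_eq_1)
  then show ?thesis
    using gradient_eq[OF GDERIV_const[of 1 \<theta>]] by simp
qed

lemma GDERIV_KL:
  fixes \<pi> :: "'a::real_inner \<Rightarrow> 'v::finite pmf"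
  assumes "\<And>j. GDERIV (\<lambda>t. pmf (\<pi> t) j) \<theta> :> G j"
    and "\<And>j. pmf (\<pi> \<theta>) j > 0" "\<And>j. pmf P j > 0"
  shows "GDERIV (\<lambda>t. KL P (\<pi> t)) \<theta> :> (\<Sum>j\<in>UNIV. pmf P j *\<^sub>R (- 1 / pmf (\<pi> \<theta>) j) *\<^sub>R G j)"
  unfolding KL_def by (intro GDERIV_sum GDERIV_cmult GDERIV_ln_const_divide assms)

text \<open>With the second argument frozen at \<open>\<theta>\<close>, the factor
  \<open>sg w\<close> and the denominator of \<open>r\<close> are constants in \<open>t\<close>, so
  no product rule is needed: the first summand comes from \<open>ln w\<close> alone, the second from
  \<open>ln r\<close>.\<close>

lemma GDERIV_K5:
  fixes \<pi> :: "'a::real_inner \<Rightarrow> 'v pmf"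
  assumes "GDERIV (\<lambda>t. pmf (\<pi> t) p) \<theta> :> D"
    and "pmf (\<pi> \<theta>) p > 0" "pmf P p > 0"
  shows "GDERIV (\<lambda>t. K5 P \<pi> p t \<theta>) \<theta> :>
    (pmf P p / pmf (\<pi> \<theta>) p) *\<^sub>R (- 1 / pmf (\<pi> \<theta>) p) *\<^sub>R D + (1 / pmf (\<pi> \<theta>) p) *\<^sub>R D"
  unfolding K5_def sg_def w_expr_def r_expr_def prob_expr_def
  by (intro GDERIV_add GDERIV_cmult GDERIV_ln_const_divide GDERIV_ln_divide_const assms)

text \<open>On the diagonal \<open>r\<close> is 1, so \<open>ln r\<close> vanishes, and the sampling
  weight cancels the denominator of the factor \<open>w\<close>.\<close>

lemma expectation_K5:
  fixes \<pi> :: "'a \<Rightarrow> 'v::finite pmf"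
  assumes "\<And>j. pmf (\<pi> \<theta>) j > 0"
  shows "measure_pmf.expectation (\<pi> \<theta>) (\<lambda>p. sg_value (K5 P \<pi> p) \<theta>) = KL P (\<pi> \<theta>)"
proof -
  have "pmf (\<pi> \<theta>) p \<noteq> 0" for p
    using assms[of p] by simp
  then show ?thesis
    by (simp add: integral_measure_pmf[of UNIV] KL_def sg_value_def K5_def sg_def w_expr_def
        r_expr_def prob_expr_def)
qed

theorem mainTheorem3:
  fixes \<pi> :: "real ^ 'd \<Rightarrow> 'v::finite pmf"
    and \<pi>ref :: "'v pmf"
    and \<theta> :: "real ^ 'd"
  assumes "\<And>t j. pmf (\<pi> t) j > 0"
    and "\<And>t j. (\<lambda>s. pmf (\<pi> s) j) differentiable (at t)"
    and "\<And>j. pmf \<pi>ref j > 0"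
  shows "measure_pmf.expectation (\<pi> \<theta>) (\<lambda>p. sg_value (K5 \<pi>ref \<pi> p) \<theta>) = KL \<pi>ref (\<pi> \<theta>)
    \<and> (\<forall>p. sg_differentiable (K5 \<pi>ref \<pi> p) \<theta>)
    \<and> (\<lambda>t. KL \<pi>ref (\<pi> t)) differentiable (at \<theta>)
    \<and> measure_pmf.expectation (\<pi> \<theta>) (\<lambda>p. sg_gradient (K5 \<pi>ref \<pi> p) \<theta>)
        = gradient (\<lambda>t. KL \<pi>ref (\<pi> t)) \<theta>"
proof -
  define q where "q = pmf (\<pi> \<theta>)"
  have "\<exists>D. GDERIV (\<lambda>t. pmf (\<pi> t) j) \<theta> :> D" for j
    using differentiable_imp_gderiv[OF assms(2)] by metis
  then obtain G where G: "\<And>j. GDERIV (\<lambda>t. pmf (\<pi> t) j) \<theta> :> G j"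
    by metis
  note K5 = GDERIV_K5[OF G assms(1) assms(3)]
  note KL = GDERIV_KL[OF G assms(1) assms(3)]
  have q: "q p \<noteq> 0" for p
    using assms(1)[of \<theta> p] by (simp add: q_def)
  \<comment> \<open>The sampling weight cancels one denominator in each term, leaving exactly the
    summand of \<open>GDERIV_KL\<close> plus a bare \<open>G p\<close>.\<close>
  have weighted: "q p *\<^sub>R ((pmf \<pi>ref p / q p) *\<^sub>R (- 1 / q p) *\<^sub>R G p + (1 / q p) *\<^sub>R G p)
      = pmf \<pi>ref p *\<^sub>R (- 1 / q p) *\<^sub>R G p + G p" for p
    using q[of p] by (simp add: scaleR_right_diff_distrib)
  have "measure_pmf.expectation (\<pi> \<theta>) (\<lambda>p. sg_gradient (K5 \<pi>ref \<pi> p) \<theta>)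
      = (\<Sum>p\<in>UNIV. pmf \<pi>ref p *\<^sub>R (- 1 / q p) *\<^sub>R G p) + (\<Sum>p\<in>UNIV. G p)"
    unfolding sg_gradient_def gradient_eq[OF K5] integral_measure_pmf[OF finite UNIV_I]
      q_def[symmetric] weighted sum.distrib ..
  also have "\<dots> = gradient (\<lambda>t. KL \<pi>ref (\<pi> t)) \<theta>"
    by (simp only: sum_gderiv_pmf_eq_0[OF G] gradient_eq[OF KL] q_def add_0_right)
  \<comment> \<open>The derivatives found above also give the differentiability conjuncts, which
    guarantee that the gradients in the last equation are genuine rather than unspecified
    values.\<close>
  finally show ?thesis
    using expectation_K5[of \<pi> \<theta>, OF assms(1)] gderiv_imp_differentiable[OF K5]
      gderiv_imp_differentiable[OF KL]
    by (simp add: sg_differentiable_def)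
qed

end
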